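(* Let $S$ be a skew-symmetric linear operator (not assumed densely defined or closed) in a real or complex Hilbert space $\mathcal{H}$. The following assertions are equivalent: (i) $S$ is skew-adjoint. (ii) $\operatorname{ran}M_{S,-S}=\mathcal{H}\times\mathcal{H}$. (iii) $G(S)^{\perp}\subseteq\operatorname{ran}M_{S,-S}$. (iv) $\operatorname{ran}(I-S^2)=\mathcal{H}$. (v) $\operatorname{ran}(I+S)=\mathcal{H}$ and $\operatorname{ran}(I-S)=\mathcal{H}$. (vi) $S^2$ is densely defined and selfadjoint: $(S^2)^*=S^2$.
   Context: Linear operators in $\mathcal{H}$ are defined on linear subspaces; products have natural domains, $\operatorname{dom}(S^2)=\{h\in\operatorname{dom}S:Sh\in\operatorname{dom}S\}$. $S$ is skew-symmetric if $(Sh\mid h')=-(h\mid Sh')$ for all $h,h'\in\operatorname{dom}S$; $S$ is skew-adjoint if it is densely defined and $S^*=-S$ (equality including domains). $G(S)=\{(h,Sh): h\in\operatorname{dom}S\}$ is the graph, $\perp$ is taken in the product Hilbert space $\mathcal{H}\times\mathcal{H}$. For operators $A,B$ in $\mathcal{H}$, $M_{A,B}$ is the operator in $\mathcal{H}\times\mathcal{H}$ with domain $\operatorname{dom}A\times\operatorname{dom}B$ given by $M_{A,B}(h,k)=(h-Bk,\,Ah+k)$. *)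

theory Defs
  imports "HOL-Analysis.Analysis"
begin

text \<open>
  The scalars are the real or the complex numbers. The axioms below leave no other possibility
  (lemma \<open>rc_field_real_or_complex\<close>): every \<open>z\<close> is a root of the real polynomial
  \<open>X\<^sup>2 - (z + rc_cnj z) X + norm z ^ 2\<close>.
\<close>

class rc_field = real_normed_field +
  fixes rc_cnj :: "'a \<Rightarrow> 'a"
  assumes rc_cnj_add: "rc_cnj (x + y) = rc_cnj x + rc_cnj y"
    and rc_cnj_mult: "rc_cnj (x * y) = rc_cnj x * rc_cnj y"
    and rc_cnj_rc_cnj: "rc_cnj (rc_cnj x) = x"
    and mult_rc_cnj_scaleR: "x * rc_cnj x = (norm x)\<^sup>2 *\<^sub>R 1"

lemma mult_rc_cnj: "x * rc_cnj x = of_real ((norm x)\<^sup>2)" for x :: "'k::rc_field"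
  by (simp add: mult_rc_cnj_scaleR scaleR_conv_of_real)

instantiation real :: rc_field
begin
definition rc_cnj_real :: "real \<Rightarrow> real" where "rc_cnj_real x = x"
instance by standard (auto simp: rc_cnj_real_def power2_eq_square)
end

instantiation complex :: rc_field
begin
definition rc_cnj_complex :: "complex \<Rightarrow> complex" where "rc_cnj_complex = cnj"
instance by standard (auto simp: rc_cnj_complex_def complex_norm_square[symmetric] scaleR_conv_of_real)
end

lemma add_rc_cnj_Reals: "x + rc_cnj x \<in> \<real>" for x :: "'k::rc_field"
proof -
  have one: "rc_cnj (1::'k) = 1"
    using mult_rc_cnj[of "1::'k"] by simp
  have "(1 + x) * rc_cnj (1 + x) = of_real ((norm (1 + x))\<^sup>2)"
    by (rule mult_rc_cnj)
  then have "1 + (x + rc_cnj x) + x * rc_cnj x = of_real ((norm (1 + x))\<^sup>2)"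
    by (simp add: rc_cnj_add one algebra_simps)
  then have "x + rc_cnj x = of_real ((norm (1 + x))\<^sup>2) - 1 - of_real ((norm x)\<^sup>2)"
    unfolding mult_rc_cnj by (simp add: algebra_simps)
  also have "\<dots> = of_real ((norm (1 + x))\<^sup>2 - 1 - (norm x)\<^sup>2)"
    by simp
  finally show ?thesis
    by (metis Reals_of_real)
qed

lemma rc_field_real_or_complex:
  "(UNIV :: 'k::rc_field set) = \<real> \<or>
   (\<exists>i::'k. i * i = - 1 \<and> rc_cnj i = - i \<and> (\<forall>z. \<exists>a b. z = of_real a + of_real b * i))"
proof (cases "\<exists>z::'k. z \<notin> \<real>")
  case True
  then obtain z :: 'k where z: "z \<notin> \<real>" by blast
  define w where "w = z - rc_cnj z"
  have cnj_minus: "rc_cnj (- x) = - rc_cnj x" for x :: 'k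
    using rc_cnj_add[of x "- x"] rc_cnj_add[of 0 "0::'k"]
    by (simp add: eq_neg_iff_add_eq_0 add.commute)
  have cnj_w: "rc_cnj w = - w"
    unfolding w_def using rc_cnj_add[of z "- rc_cnj z"]
    by (simp add: rc_cnj_rc_cnj cnj_minus)
  have w0: "w \<noteq> 0"
  proof
    assume "w = 0"
    then have "z + rc_cnj z = 2 * z" by (simp add: w_def)
    then have "2 * z \<in> \<real>" using add_rc_cnj_Reals[of z] by simp
    then have "(2 * z) / 2 \<in> \<real>" by (intro Reals_divide) simp_all
    then show False using z by simp
  qed
  have cnj_real: "rc_cnj (of_real r) = (of_real r :: 'k)" for r
  proof (cases "r = 0")
    case True
    then show ?thesis using rc_cnj_add[of 0 "0::'k"] by simp
  next
    case False
    have "of_real r * rc_cnj (of_real r :: 'k) = of_real r * of_real r"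
      by (simp add: mult_rc_cnj power2_eq_square)
    then show ?thesis using False by simp
  qed
  define i where "i = w / of_real (norm w)"
  have nw: "of_real (norm w) \<noteq> (0::'k)" using w0 by simp
  have wi: "w = of_real (norm w) * i" using nw by (simp add: i_def)
  have "rc_cnj w = of_real (norm w) * rc_cnj i"
    by (subst wi) (simp add: rc_cnj_mult cnj_real)
  then have "of_real (norm w) * rc_cnj i = of_real (norm w) * (- i)"
    using cnj_w wi by simp
  then have cnj_i: "rc_cnj i = - i" using nw by (metis mult_left_cancel)
  have "norm i = 1" using w0 by (simp add: i_def norm_divide)
  then have "i * rc_cnj i = 1" by (simp add: mult_rc_cnj)
  then have "- (i * i) = 1" by (simp add: cnj_i)
  then have ii: "i * i = - 1" by (metis minus_equation_iff)
  have "\<exists>a b. y = of_real a + of_real b * i" for y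
  proof -
    obtain a where a: "y + rc_cnj y = of_real a"
      using add_rc_cnj_Reals[of y] by (auto elim: Reals_cases)
    obtain b where b: "y * i + rc_cnj (y * i) = of_real b"
      using add_rc_cnj_Reals[of "y * i"] by (auto elim: Reals_cases)
    have "(y - rc_cnj y) * i = of_real b"
      using b by (simp add: rc_cnj_mult cnj_i algebra_simps)
    then have "(y - rc_cnj y) * (i * i) = of_real b * i"
      by (simp add: mult.assoc[symmetric])
    then have "rc_cnj y = y + of_real b * i" by (simp add: ii algebra_simps)
    then have "2 * y = of_real a - of_real b * i"
      using a by (simp add: algebra_simps)
    then have "y = (of_real a - of_real b * i) / 2" by (simp add: eq_divide_eq mult.commute)
    also have "\<dots> = of_real (a / 2) + of_real (- b / 2) * i"
      by (simp add: field_simps)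
    finally show ?thesis by blast
  qed
  then show ?thesis using ii cnj_i by blast
qed blast

text \<open>
  The inner product is linear in its first argument. The norm, metric, topology and completeness
  of the space are those of the class \<open>banach\<close>; \<open>ip_self\<close> ties them to the inner product.
\<close>

locale hilbert_space = vector_space smul
  for smul :: "'k::rc_field \<Rightarrow> 'a::banach \<Rightarrow> 'a" +
  fixes ip :: "'a \<Rightarrow> 'a \<Rightarrow> 'k"
  assumes scale_of_real: "smul (of_real r) x = r *\<^sub>R x"
    and ip_add_left: "ip (x + y) z = ip x z + ip y z"
    and ip_scale_left: "ip (smul c x) y = c * ip x y"
    and ip_commute: "ip y x = rc_cnj (ip x y)"
    and ip_self: "ip x x = of_real ((norm x)\<^sup>2)"

lemma hilbert_space_real:
  "hilbert_space scaleR (inner :: 'a::{real_inner, banach} \<Rightarrow> 'a \<Rightarrow> real)"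
  by unfold_locales
    (auto simp: algebra_simps inner_add_left inner_commute rc_cnj_real_def power2_norm_eq_inner)

lemma hilbert_space_complex: "hilbert_space (*) (\<lambda>x y :: complex. x * cnj y)"
  by unfold_locales
    (auto simp: algebra_simps rc_cnj_complex_def complex_norm_square[symmetric] scaleR_conv_of_real)

definition prod_ip :: "('a \<Rightarrow> 'a \<Rightarrow> 'k::plus) \<Rightarrow> 'a \<times> 'a \<Rightarrow> 'a \<times> 'a \<Rightarrow> 'k" where
  "prod_ip ip p q = ip (fst p) (fst q) + ip (snd p) (snd q)"

lemma hilbert_space_prod:
  assumes "hilbert_space smul ip"
  shows "hilbert_space (\<lambda>c p. (smul c (fst p), smul c (snd p))) (prod_ip ip)"
proof -
  interpret hilbert_space smul ip by fact
  show ?thesis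
    by unfold_locales
      (auto simp: prod_ip_def prod_eq_iff scale_right_distrib scale_left_distrib scale_of_real
        ip_add_left ip_scale_left ip_self rc_cnj_add ip_commute[symmetric] norm_prod_def
        distrib_left)
qed

definition orthogonal_complement :: "('a \<Rightarrow> 'a \<Rightarrow> 'k::zero) \<Rightarrow> 'a set \<Rightarrow> 'a set" where
  "orthogonal_complement ip A = {x. \<forall>y\<in>A. ip x y = 0}"

text \<open>
  An operator in \<open>'a\<close> is a partial map \<open>'a \<rightharpoonup> 'a\<close>, so that equality of operators includes equality
  of domains, \<open>dom\<close>, \<open>ran\<close> and \<open>Map.graph\<close> are its domain, range and graph, and \<open>S \<circ>\<^sub>m T\<close> is the
  product with its natural domain. The identity is \<open>Some\<close>.
\<close>

definition linear_operator :: "('k::field \<Rightarrow> 'a::ab_group_add \<Rightarrow> 'a) \<Rightarrow> ('a \<rightharpoonup> 'a) \<Rightarrow> bool" where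
  "linear_operator smul S \<longleftrightarrow>
     module.subspace smul (dom S) \<and>
     (\<forall>x\<in>dom S. \<forall>y\<in>dom S. the (S (x + y)) = the (S x) + the (S y)) \<and>
     (\<forall>c. \<forall>x\<in>dom S. the (S (smul c x)) = smul c (the (S x)))"

definition op_uminus :: "('a \<rightharpoonup> 'a::ab_group_add) \<Rightarrow> ('a \<rightharpoonup> 'a)" where
  "op_uminus S = (\<lambda>x. map_option uminus (S x))"

definition op_plus :: "('a \<rightharpoonup> 'a::ab_group_add) \<Rightarrow> ('a \<rightharpoonup> 'a) \<Rightarrow> ('a \<rightharpoonup> 'a)" where
  "op_plus S T = (\<lambda>x. case (S x, T x) of (Some u, Some v) \<Rightarrow> Some (u + v) | _ \<Rightarrow> None)"

definition op_minus :: "('a \<rightharpoonup> 'a::ab_group_add) \<Rightarrow> ('a \<rightharpoonup> 'a) \<Rightarrow> ('a \<rightharpoonup> 'a)" where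
  "op_minus S T = op_plus S (op_uminus T)"

definition block_op ::
    "('a \<rightharpoonup> 'a::ab_group_add) \<Rightarrow> ('a \<rightharpoonup> 'a) \<Rightarrow> ('a \<times> 'a \<rightharpoonup> 'a \<times> 'a)" where
  "block_op A B =
     (\<lambda>(h, k). case (A h, B k) of (Some u, Some v) \<Rightarrow> Some (h - v, u + k) | _ \<Rightarrow> None)"

definition densely_defined :: "('a::topological_space \<rightharpoonup> 'a) \<Rightarrow> bool" where
  "densely_defined S \<longleftrightarrow> closure (dom S) = UNIV"

text \<open>
  The vector \<open>y\<close> below is unique when \<open>S\<close> is densely defined; for other \<open>S\<close> the definition is
  not meaningful.
\<close>

definition adjoint_op :: "('a \<Rightarrow> 'a \<Rightarrow> 'k) \<Rightarrow> ('a \<rightharpoonup> 'a) \<Rightarrow> ('a \<rightharpoonup> 'a)" where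
  "adjoint_op ip S = (\<lambda>x.
     if \<exists>y. \<forall>h\<in>dom S. ip (the (S h)) x = ip h y
     then Some (THE y. \<forall>h\<in>dom S. ip (the (S h)) x = ip h y)
     else None)"

definition skew_symmetric :: "('a \<Rightarrow> 'a \<Rightarrow> 'k::uminus) \<Rightarrow> ('a \<rightharpoonup> 'a) \<Rightarrow> bool" where
  "skew_symmetric ip S \<longleftrightarrow> (\<forall>h\<in>dom S. \<forall>h'\<in>dom S. ip (the (S h)) h' = - ip h (the (S h')))"

definition skew_adjoint ::
    "('a \<Rightarrow> 'a \<Rightarrow> 'k) \<Rightarrow> ('a::{topological_space, ab_group_add} \<rightharpoonup> 'a) \<Rightarrow> bool" where
  "skew_adjoint ip S \<longleftrightarrow> densely_defined S \<and> adjoint_op ip S = op_uminus S"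

end

theory Submission imports Defs begin

text \<open>
  If \<open>A\<close> and \<open>B\<close> are formal adjoints of each other and \<open>I - A\<close> and \<open>I - B\<close> are onto, then \<open>A\<close> is
  densely defined and its adjoint is \<open>B\<close>. With \<open>(A, B) = (S, -S)\<close> this gives (v) \<open>\<Longrightarrow>\<close> (i), and
  with \<open>A = B = S\<^sup>2\<close> it gives (iv) \<open>\<Longrightarrow>\<close> (vi). The factorisation of \<open>I - S\<^sup>2\<close> relates (iv) and (v),
  and the change of variables \<open>(h, k) \<mapsto> (h + k, h - k)\<close> relates (ii) and (v). Under (iii), the
  orthogonal complement of \<open>G(S)\<close> equals \<open>{(Sk, k)}\<close>, so \<open>G(S)\<close> is closed and the orthogonal
  decomposition along \<open>G(S)\<close> yields (ii). Under (vi), \<open>S\<^sup>2 \<le> 0\<close> makes \<open>I - S\<^sup>2\<close> bounded below on a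
  closed graph, so its range is closed; the complement of the range is the kernel of \<open>I - S\<^sup>2\<close>,
  which is trivial.
\<close>

section \<open>Orthogonality in a Hilbert space\<close>

context hilbert_space
begin

section \<open>Sesquilinearity and the Cauchy-Schwarz inequality\<close>

lemma rc_cnj_zero [simp]: "rc_cnj (0::'k) = 0"
  using rc_cnj_add[of 0 "0::'k"] by simp

lemma ip_add_right: "ip x (y + z) = ip x y + ip x z"
  by (metis ip_commute ip_add_left rc_cnj_add)

lemma ip_scale_right: "ip x (smul c y) = rc_cnj c * ip x y"
  by (metis ip_commute ip_scale_left rc_cnj_mult)

lemma ip_zero_left [simp]: "ip 0 x = 0"
  using ip_add_left[of 0 0 x] by simp

lemma ip_zero_right [simp]: "ip x 0 = 0"
  using ip_add_right[of x 0 0] by simp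

lemma ip_minus_left [simp]: "ip (- x) y = - ip x y"
  using ip_add_left[of x "- x" y] by (simp add: eq_neg_iff_add_eq_0 add.commute)

lemma ip_minus_right [simp]: "ip x (- y) = - ip x y"
  using ip_add_right[of x y "- y"] by (simp add: eq_neg_iff_add_eq_0 add.commute)

lemma ip_diff_left: "ip (x - y) z = ip x z - ip y z"
  using ip_add_left[of x "- y" z] by simp

lemma ip_diff_right: "ip x (y - z) = ip x y - ip x z"
  using ip_add_right[of x y "- z"] by simp

lemma ip_self_eq_0_iff [simp]: "ip x x = 0 \<longleftrightarrow> x = 0"
  by (simp add: ip_self)

lemma ip_eq_0_commute: "ip x y = 0 \<longleftrightarrow> ip y x = 0"
  by (metis ip_commute rc_cnj_zero)

text \<open>Pythagoras for the component of \<open>x\<close> orthogonal to \<open>y\<close>. The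
  exact loss of squared length gives the Cauchy-Schwarz inequality and, later, the orthogonality of
  the remainder at a nearest point.\<close>

lemma norm_diff_projection:
  assumes "y \<noteq> 0"
  shows "(norm (x - smul (ip x y / ip y y) y))\<^sup>2 = (norm x)\<^sup>2 - (norm (ip x y))\<^sup>2 / (norm y)\<^sup>2"
proof -
  define c where "c = ip x y / ip y y"
  have c: "c * ip y y = ip x y"
    using assms by (simp add: c_def)
  have "(of_real ((norm (x - smul c y))\<^sup>2) :: 'k) = ip (x - smul c y) (x - smul c y)"
    by (simp add: ip_self)
  also have "\<dots> = ip x x - c * ip y x - rc_cnj c * ip x y + rc_cnj c * (c * ip y y)"
    by (simp add: ip_diff_left ip_diff_right ip_scale_left ip_scale_right algebra_simps)
  also have "\<dots> = ip x x - c * rc_cnj (ip x y)"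
    by (simp add: c ip_commute[of y x])
  also have "c * rc_cnj (ip x y) = ip x y * rc_cnj (ip x y) / ip y y"
    by (simp add: c_def)
  also have "\<dots> = of_real ((norm (ip x y))\<^sup>2 / (norm y)\<^sup>2)"
    by (simp add: mult_rc_cnj ip_self)
  also have "ip x x - \<dots> = of_real ((norm x)\<^sup>2 - (norm (ip x y))\<^sup>2 / (norm y)\<^sup>2)"
    by (simp add: ip_self)
  finally show ?thesis
    unfolding of_real_eq_iff c_def .
qed

lemma Cauchy_Schwarz: "norm (ip x y) \<le> norm x * norm y"
proof (cases "y = 0")
  case False
  then have "(norm (ip x y))\<^sup>2 / (norm y)\<^sup>2 \<le> (norm x)\<^sup>2"
    using norm_diff_projection[OF False, of x] zero_le_power2[of "norm (x - smul (ip x y / ip y y) y)"]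
    by linarith
  then have "(norm (ip x y))\<^sup>2 \<le> (norm x * norm y)\<^sup>2"
    using False by (simp add: pos_divide_le_eq power_mult_distrib)
  then show ?thesis
    by (rule power2_le_imp_le) simp
qed simp

section \<open>Continuity of the inner product and closures of subspaces\<close>

lemma ip_scaleR_left: "ip (r *\<^sub>R x) y = r *\<^sub>R ip x y"
  by (simp add: scale_of_real[symmetric] ip_scale_left scaleR_conv_of_real)

lemma bounded_linear_ip_left: "bounded_linear (\<lambda>x. ip x y)"
  by (rule bounded_linear_intro[of _ "norm y"])
    (auto simp: ip_add_left ip_scaleR_left Cauchy_Schwarz)

lemma closed_orthogonal_complement: "closed (orthogonal_complement ip A)"
proof -
  have "orthogonal_complement ip A = (\<Inter>y\<in>A. {x. ip x y = 0})"
    by (auto simp: orthogonal_complement_def)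
  then show ?thesis
    by (auto intro!: closed_INT closed_Collect_eq continuous_intros
        bounded_linear.continuous_on[OF bounded_linear_ip_left])
qed

text \<open>Restriction of scalars: nearest points and images of complete subspaces are handled by
  real linear arguments.\<close>

lemma real_subspace:
  assumes "subspace M"
  shows "Real_Vector_Spaces.subspace M"
  using assms unfolding subspace_def Real_Vector_Spaces.subspace_def
  by (metis scale_of_real)

lemma subspace_closure:
  assumes "subspace M"
  shows "subspace (closure M)"
proof -
  have "x + y \<in> closure M" if x: "x \<in> closure M" and y: "y \<in> closure M" for x y
  proof -
    obtain f where "\<forall>n. f n \<in> M" "f \<longlonglongrightarrow> x"
      using x unfolding closure_sequential by blast
    moreover obtain g where "\<forall>n. g n \<in> M" "g \<longlonglongrightarrow> y"
      using y unfolding closure_sequential by blast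
    ultimately have "\<forall>n. f n + g n \<in> M" "(\<lambda>n. f n + g n) \<longlonglongrightarrow> x + y"
      using assms by (auto intro: subspace_add tendsto_add)
    then show ?thesis
      unfolding closure_sequential by (intro exI conjI)
  qed
  moreover
  have "smul c x \<in> closure M" if "x \<in> closure M" for c x
  proof -
    have n: "norm (smul c x) = norm c * norm x" for x
    proof -
      have "(of_real ((norm (smul c x))\<^sup>2) :: 'k) = c * rc_cnj c * ip x x"
        by (simp only: ip_self[symmetric]) (simp add: ip_scale_left ip_scale_right mult.assoc)
      also have "\<dots> = of_real ((norm c * norm x)\<^sup>2)"
        by (simp add: mult_rc_cnj ip_self power_mult_distrib)
      finally show ?thesis
        unfolding of_real_eq_iff by (simp add: power2_eq_iff_nonneg)
    qed
    \<comment> \<open>Even for a nonreal \<open>c\<close> this map is real linear and bounded, so it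
      carries limits of points of \<open>M\<close> to limits of their multiples.\<close>
    have "bounded_linear (smul c)"
      by (rule bounded_linear_intro[of _ "norm c"])
        (auto simp: scale_right_distrib n scale_of_real[symmetric] scale_left_commute mult.commute)
    then have "smul c ` closure M \<subseteq> closure (smul c ` M)"
      by (rule closure_bounded_linear_image_subset)
    also have "\<dots> \<subseteq> closure M"
      using assms by (intro closure_mono) (auto simp: subspace_scale)
    finally show ?thesis
      using that by blast
  qed
  moreover have "0 \<in> closure M"
    using assms closure_subset subspace_0 by blast
  ultimately show ?thesis
    unfolding subspace_def by blast
qed

section \<open>Nearest points and orthogonal projection\<close>

lemma parallelogram:
  fixes x y :: 'a
  shows "(norm (x + y))\<^sup>2 + (norm (x - y))\<^sup>2 = 2 * (norm x)\<^sup>2 + 2 * (norm y)\<^sup>2"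
proof -
  have "ip (x + y) (x + y) + ip (x - y) (x - y) = 2 * ip x x + 2 * ip y y"
    by (simp add: ip_add_left ip_add_right ip_diff_left ip_diff_right algebra_simps)
  then have "(of_real ((norm (x + y))\<^sup>2 + (norm (x - y))\<^sup>2) :: 'k)
      = of_real (2 * (norm x)\<^sup>2 + 2 * (norm y)\<^sup>2)"
    by (simp add: ip_self)
  then show ?thesis
    unfolding of_real_eq_iff .
qed

text \<open>The sets \<open>C n\<close> of near-minimisers are closed, nonempty and nested, and the
  parallelogram law makes their diameters tend to 0. Completeness yields a common point, which
  attains the distance \<open>d\<close>.\<close>

lemma closest_point_exists:
  fixes M :: "'a set"
  assumes "closed M" "Real_Vector_Spaces.subspace M"
  obtains m where "m \<in> M" "\<And>v. v \<in> M \<Longrightarrow> norm (x - m) \<le> norm (x - v)"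
proof -
  define d where "d = infdist x M"
  have ne: "M \<noteq> {}"
    using assms(2) by (auto simp: Real_Vector_Spaces.subspace_def)
  have d: "d \<le> norm (x - v)" if "v \<in> M" for v
    using infdist_le[OF that, of x] by (simp add: d_def dist_norm)
  have d0: "d \<ge> 0"
    by (simp add: d_def infdist_nonneg)
  define C where "C n = {m \<in> M. (norm (x - m))\<^sup>2 \<le> d\<^sup>2 + inverse (real (Suc n))}" for n
  have close: "(dist u v)\<^sup>2 \<le> 4 * inverse (real (Suc n))" if "u \<in> C n" "v \<in> C n" for u v n
  proof -
    \<comment> \<open>The midpoint stays in \<open>M\<close>, hence at distance at least
      \<open>d\<close> from \<open>x\<close>. The parallelogram law for \<open>x - u\<close> and
      \<open>x - v\<close> then cancels \<open>4 * d^2\<close> and leaves four times the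
      tolerance.\<close>
    have "(1/2) *\<^sub>R (u + v) \<in> M"
      using that assms(2) by (auto simp: C_def Real_Vector_Spaces.subspace_def)
    then have "d\<^sup>2 \<le> (norm (x - (1/2) *\<^sub>R (u + v)))\<^sup>2"
      by (intro power_mono d d0)
    moreover have "(x - u) + (x - v) = 2 *\<^sub>R (x - (1/2) *\<^sub>R (u + v))"
      by (simp add: algebra_simps scaleR_2)
    then have "(norm ((x - u) + (x - v)))\<^sup>2 = 4 * (norm (x - (1/2) *\<^sub>R (u + v)))\<^sup>2"
      by (simp add: power_mult_distrib)
    moreover have "(norm ((x - u) - (x - v)))\<^sup>2 = (dist u v)\<^sup>2"
      by (simp add: dist_norm norm_minus_commute)
    ultimately show ?thesis
      using parallelogram[of "x - u" "x - v"] that by (auto simp: C_def)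
  qed
  have "\<exists>a. \<forall>n. a \<in> C n"
  proof (rule decreasing_closed_nest[of C])
    fix n
    have "closed {m. (norm (x - m))\<^sup>2 \<le> d\<^sup>2 + inverse (real (Suc n))}"
      by (intro closed_Collect_le continuous_intros)
    then show "closed (C n)"
      using assms(1) by (auto simp: C_def Collect_conj_eq)
    have "d < sqrt (d\<^sup>2 + inverse (real (Suc n)))"
      by (rule real_less_rsqrt) simp
    then obtain v where v: "v \<in> M" "norm (x - v) < sqrt (d\<^sup>2 + inverse (real (Suc n)))"
      unfolding d_def infdist_notempty[OF ne] dist_norm using cINF_less_iff[of M "\<lambda>a. norm (x - a)"] ne
      by (metis bdd_belowI2 norm_ge_zero)
    then have "(norm (x - v))\<^sup>2 \<le> (sqrt (d\<^sup>2 + inverse (real (Suc n))))\<^sup>2"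
      by (intro power_mono) auto
    then have "v \<in> C n"
      using v(1) by (simp add: C_def)
    then show "C n \<noteq> {}"
      by blast
  next
    fix m n :: nat assume "m \<le> n"
    then have "inverse (real (Suc n)) \<le> inverse (real (Suc m))"
      by (intro le_imp_inverse_le) auto
    then show "C n \<subseteq> C m"
      unfolding C_def by (blast intro: order_trans add_left_mono)
  next
    fix e :: real assume "e > 0"
    then obtain n where n: "inverse (real (Suc n)) < e\<^sup>2 / 4"
      using reals_Archimedean[of "e\<^sup>2 / 4"] by auto
    have "dist u v < e" if "u \<in> C n" "v \<in> C n" for u v
      using close[OF that] n \<open>e > 0\<close> by (intro power2_less_imp_less[of _ e]) auto
    then show "\<exists>n. \<forall>u\<in>C n. \<forall>v\<in>C n. dist u v < e"
      by blast
  qed blast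
  then obtain m where m: "m \<in> C n" for n
    by blast
  have "(norm (x - m))\<^sup>2 \<le> d\<^sup>2"
  proof (rule field_le_epsilon)
    fix e :: real assume "e > 0"
    then obtain n where "inverse (real (Suc n)) < e"
      using reals_Archimedean by blast
    then show "(norm (x - m))\<^sup>2 \<le> d\<^sup>2 + e"
      using m[of n] by (simp add: C_def)
  qed
  then have "norm (x - m) \<le> d"
    using d0 by (rule power2_le_imp_le)
  then show thesis
    using that m d by (fastforce simp: C_def)
qed

text \<open>Take \<open>m\<close> nearest to \<open>x\<close>. If \<open>x - m\<close> were not
  orthogonal to some \<open>y\<close> in \<open>M\<close>, moving \<open>m\<close> by the projection
  of \<open>x - m\<close> onto \<open>y\<close> would bring it strictly closer.\<close>

lemma orthogonal_decomposition:
  assumes "closed M" "subspace M"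
  obtains m where "m \<in> M" "x - m \<in> orthogonal_complement ip M"
proof -
  obtain m where m: "m \<in> M" "\<And>v. v \<in> M \<Longrightarrow> norm (x - m) \<le> norm (x - v)"
    using closest_point_exists[OF assms(1) real_subspace[OF assms(2)]] by metis
  have "ip (x - m) y = 0" if "y \<in> M" for y
  proof (cases "y = 0")
    case False
    let ?p = "smul (ip (x - m) y / ip y y) y"
    have "m + ?p \<in> M"
      using assms(2) m(1) that by (simp add: subspace_add subspace_scale)
    from m(2)[OF this] have "(norm (x - m))\<^sup>2 \<le> (norm (x - m - ?p))\<^sup>2"
      by (simp add: diff_diff_eq)
    then have "(norm (ip (x - m) y))\<^sup>2 / (norm y)\<^sup>2 \<le> 0"
      unfolding norm_diff_projection[OF False] by simp
    then show ?thesis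
      using False by (simp add: divide_le_0_iff)
  qed simp
  then show thesis
    using that m(1) by (auto simp: orthogonal_complement_def)
qed

text \<open>A vector orthogonal to a dense set is orthogonal to itself, since its complement is
  closed. Conversely, decompose any \<open>x\<close> along the closure of \<open>M\<close>: the
  remainder is orthogonal to \<open>M\<close> and so vanishes.\<close>

lemma closure_eq_UNIV_iff:
  assumes "subspace M"
  shows "closure M = UNIV \<longleftrightarrow> orthogonal_complement ip M \<subseteq> {0}"
proof
  assume M: "closure M = UNIV"
  show "orthogonal_complement ip M \<subseteq> {0}"
  proof
    fix z assume "z \<in> orthogonal_complement ip M"
    then have "M \<subseteq> orthogonal_complement ip {z}"
      by (auto simp: orthogonal_complement_def ip_eq_0_commute[of z])
    then have "closure M \<subseteq> orthogonal_complement ip {z}"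
      by (rule closure_minimal) (rule closed_orthogonal_complement)
    then have "z \<in> orthogonal_complement ip {z}"
      using M by blast
    then show "z \<in> {0}"
      by (simp add: orthogonal_complement_def)
  qed
next
  assume 0: "orthogonal_complement ip M \<subseteq> {0}"
  have "x \<in> closure M" for x
  proof -
    obtain m where m: "m \<in> closure M" "x - m \<in> orthogonal_complement ip (closure M)"
      using orthogonal_decomposition[OF closed_closure subspace_closure[OF assms]] .
    then have "x - m \<in> orthogonal_complement ip M"
      using closure_subset[of M] by (auto simp: orthogonal_complement_def)
    then show ?thesis
      using 0 m(1) by auto
  qed
  then show "closure M = UNIV"
    by blast
qed

end


section \<open>Ranges and adjoints of partial operators\<close>

lemma op_uminus_eq_Some_iff: "op_uminus A x = Some y \<longleftrightarrow> A x = Some (- y)"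
  by (auto simp: op_uminus_def minus_equation_iff)

lemma op_minus_op_uminus: "op_minus A (op_uminus B) = op_plus A B"
  by (rule ext) (auto simp: op_minus_def op_plus_def op_uminus_def split: option.splits)

lemma op_plus_Some_eq_Some_iff: "op_plus Some A h = Some y \<longleftrightarrow> (\<exists>u. A h = Some u \<and> y = h + u)"
  by (auto simp: op_plus_def split: option.splits)

lemma op_minus_Some_eq_Some_iff: "op_minus Some A h = Some y \<longleftrightarrow> (\<exists>u. A h = Some u \<and> y = h - u)"
  by (auto simp: op_minus_def op_plus_def op_uminus_def split: option.splits)

lemma block_op_uminus_eq_Some_iff:
  "block_op A (op_uminus B) (h, k) = Some p \<longleftrightarrow>
     (\<exists>u v. A h = Some u \<and> B k = Some v \<and> p = (h + v, u + k))"
  by (auto simp: block_op_def op_uminus_def split: option.splits)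

lemma ran_op_plus_Some: "ran (op_plus Some A) = {h + u |h u. A h = Some u}"
  unfolding ran_def op_plus_Some_eq_Some_iff by blast

lemma ran_op_minus_Some: "ran (op_minus Some A) = {h - u |h u. A h = Some u}"
  unfolding ran_def op_minus_Some_eq_Some_iff by blast

lemma mem_ran_block_op_uminus:
  "(a, b) \<in> ran (block_op A (op_uminus B)) \<longleftrightarrow>
     (\<exists>h k u v. A h = Some u \<and> B k = Some v \<and> a = h + v \<and> b = u + k)"
  unfolding ran_def split_paired_Ex block_op_uminus_eq_Some_iff by auto

lemma in_graph_iff: "(x, y) \<in> Map.graph A \<longleftrightarrow> A x = Some y"
  by (simp add: Map.graph_def)

lemma map_comp_eq_Some_iff: "(S \<circ>\<^sub>m T) x = Some y \<longleftrightarrow> (\<exists>u. T x = Some u \<and> S u = Some y)"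
  by (auto simp: map_comp_def split: option.splits)

context hilbert_space
begin

text \<open>Two candidates for \<open>y\<close> differ by a vector orthogonal to the dense domain
  and hence agree, so the definite description in \<open>adjoint_op\<close> returns the one that is
  given.\<close>

lemma adjoint_op_eq_Some_iff:
  assumes "subspace (dom A)" "densely_defined A"
  shows "adjoint_op ip A x = Some y \<longleftrightarrow> (\<forall>h u. A h = Some u \<longrightarrow> ip u x = ip h y)"
proof -
  define P where "P y \<longleftrightarrow> (\<forall>h\<in>dom A. ip (the (A h)) x = ip h y)" for y
  have "y = y'" if P: "P y" "P y'" for y y'
  proof -
    have "ip h (y - y') = 0" if "h \<in> dom A" for h
      using P that by (simp add: P_def ip_diff_right del: domIff)
    then have "y - y' \<in> orthogonal_complement ip (dom A)"
      by (simp add: orthogonal_complement_def ip_eq_0_commute[of "y - y'"] del: domIff)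
    then have "y - y' \<in> {0}"
      using closure_eq_UNIV_iff[OF assms(1)] assms(2) unfolding densely_defined_def by blast
    then show ?thesis
      by simp
  qed
  then have "The P = y" if "P y" for y
    using that by (blast intro: the_equality)
  then have "adjoint_op ip A x = Some y \<longleftrightarrow> P y"
    unfolding adjoint_op_def P_def[symmetric] by auto
  also have "P y \<longleftrightarrow> (\<forall>h u. A h = Some u \<longrightarrow> ip u x = ip h y)"
    unfolding P_def by (metis domD domI option.sel)
  finally show ?thesis .
qed

text \<open>A vector orthogonal to the range of \<open>I - A\<close> is zero. Surjectivity of
  \<open>I - B\<close> produces a vector \<open>k\<close> to which this applies, once for the
  density and once for the inclusion of the adjoint in \<open>B\<close>.\<close>

lemma adjoint_op_eqI:
  assumes "subspace (dom A)" and B0: "B 0 = Some 0"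
    and adj: "\<And>h u k v. A h = Some u \<Longrightarrow> B k = Some v \<Longrightarrow> ip u k = ip h v"
    and A: "ran (op_minus Some A) = UNIV" and B: "ran (op_minus Some B) = UNIV"
  shows "densely_defined A" "adjoint_op ip A = B"
proof -
  have A0: "z = 0" if "\<And>h u. A h = Some u \<Longrightarrow> ip (h - u) z = 0" for z
  proof -
    obtain h u where "A h = Some u" "z = h - u"
      using A unfolding ran_op_minus_Some by blast
    then show ?thesis
      using that by (metis ip_self_eq_0_iff)
  qed
  have B': "\<exists>k v. B k = Some v \<and> z = k - v" for z
    using B unfolding ran_op_minus_Some by blast
  have "z = 0" if "z \<in> orthogonal_complement ip (dom A)" for z
  proof -
    obtain k v where k: "B k = Some v" "z = k - v"
      using B' by blast
    \<comment> \<open>Formal adjointness moves \<open>I - A\<close> across the inner product and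
      turns \<open>k\<close> into \<open>k - v = z\<close>, which is orthogonal to
      \<open>h\<close>.\<close>
    have "ip (h - u) k = 0" if "A h = Some u" for h u
    proof -
      have "ip (h - u) k = ip h z"
        using adj[OF that k(1)] by (simp add: k(2) ip_diff_left ip_diff_right)
      then show ?thesis
        using \<open>z \<in> _\<close> that by (auto simp: orthogonal_complement_def ip_eq_0_commute[of z])
    qed
    then have "k = 0" by (rule A0)
    then show ?thesis
      using k B0 by simp
  qed
  then show dense: "densely_defined A"
    unfolding densely_defined_def closure_eq_UNIV_iff[OF assms(1)] by blast
  have "adjoint_op ip A x = Some y \<longleftrightarrow> B x = Some y" for x y
  proof
    assume "adjoint_op ip A x = Some y"
    then have xy: "ip u x = ip h y" if "A h = Some u" for h u
      using that adjoint_op_eq_Some_iff[OF assms(1) dense] by blast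
    \<comment> \<open>Here \<open>y\<close> is the adjoint applied to \<open>x\<close>. Choosing
      \<open>k\<close> with the same image under \<open>I - B\<close> makes \<open>x - k\<close>
      orthogonal to the range of \<open>I - A\<close>, so \<open>x = k\<close> and
      \<open>y = v\<close>.\<close>
    obtain k v where k: "B k = Some v" "x - y = k - v"
      using B' by blast
    have "x - k = 0"
    proof (rule A0)
      fix h u assume "A h = Some u"
      from xy[OF this] adj[OF this k(1)] have "ip (h - u) (x - k) = ip h ((x - y) - (k - v))"
        by (simp add: ip_diff_left ip_diff_right)
      then show "ip (h - u) (x - k) = 0"
        by (simp add: k(2))
    qed
    then show "B x = Some y"
      using k by simp
  next
    assume "B x = Some y"
    then show "adjoint_op ip A x = Some y"
      using adjoint_op_eq_Some_iff[OF assms(1) dense] adj by blast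
  qed
  then show "adjoint_op ip A = B"
    by (metis (no_types) ext not_Some_eq)
qed

text \<open>A form free of \<open>the\<close> and of domain conditions, in which linearity passes to
  products, graphs and ranges by logic alone.\<close>

lemma linear_operator_iff:
  "linear_operator smul T \<longleftrightarrow> T 0 = Some 0 \<and>
     (\<forall>x y u v. T x = Some u \<longrightarrow> T y = Some v \<longrightarrow> T (x + y) = Some (u + v)) \<and>
     (\<forall>c x u. T x = Some u \<longrightarrow> T (smul c x) = Some (smul c u))"
proof
  assume L: "linear_operator smul T"
  then have dom: "subspace (dom T)"
    and add: "\<And>x y. x \<in> dom T \<Longrightarrow> y \<in> dom T \<Longrightarrow> the (T (x + y)) = the (T x) + the (T y)"
    and scale: "\<And>c x. x \<in> dom T \<Longrightarrow> the (T (smul c x)) = smul c (the (T x))"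
    unfolding linear_operator_def by blast+
  have some: "T x = Some (the (T x))" if "x \<in> dom T" for x
    using that by auto
  have "T 0 = Some 0"
    using some[OF subspace_0[OF dom]] scale[OF subspace_0[OF dom], of 0] by simp
  moreover have "T (x + y) = Some (u + v)" if "T x = Some u" "T y = Some v" for x y u v
    using some[OF subspace_add[OF dom, of x y]] add[of x y] that by (simp add: domI)
  moreover have "T (smul c x) = Some (smul c u)" if "T x = Some u" for c x u
    using some[OF subspace_scale[OF dom, of x c]] scale[of x c] that by (simp add: domI)
  ultimately show "T 0 = Some 0 \<and>
     (\<forall>x y u v. T x = Some u \<longrightarrow> T y = Some v \<longrightarrow> T (x + y) = Some (u + v)) \<and>
     (\<forall>c x u. T x = Some u \<longrightarrow> T (smul c x) = Some (smul c u))"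
    by blast
next
  assume "T 0 = Some 0 \<and>
     (\<forall>x y u v. T x = Some u \<longrightarrow> T y = Some v \<longrightarrow> T (x + y) = Some (u + v)) \<and>
     (\<forall>c x u. T x = Some u \<longrightarrow> T (smul c x) = Some (smul c u))"
  then show "linear_operator smul T"
    unfolding linear_operator_def subspace_def by (auto simp: dom_def)
qed

lemma linear_operator_map_comp:
  assumes "linear_operator smul S" "linear_operator smul T"
  shows "linear_operator smul (S \<circ>\<^sub>m T)"
  using assms unfolding linear_operator_iff map_comp_eq_Some_iff by blast

lemma subspace_dom: "linear_operator smul T \<Longrightarrow> subspace (dom T)"
  by (simp add: linear_operator_def)

lemma subspace_graph:
  assumes "linear_operator smul T"
  shows "module.subspace (\<lambda>c p. (smul c (fst p), smul c (snd p))) (Map.graph T)"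
proof -
  interpret P: hilbert_space "\<lambda>c p. (smul c (fst p), smul c (snd p))" "prod_ip ip"
    using hilbert_space_axioms by (rule hilbert_space_prod)
  show ?thesis
    using assms unfolding P.subspace_def linear_operator_iff
    by (auto simp: Map.graph_def zero_prod_def)
qed

lemma subspace_ran_op_minus:
  assumes "linear_operator smul T"
  shows "subspace (ran (op_minus Some T))"
proof (rule subspaceI)
  note T = assms[unfolded linear_operator_iff]
  show "0 \<in> ran (op_minus Some T)"
    unfolding ran_op_minus_Some using T by force
  show "x + y \<in> ran (op_minus Some T)"
    if x: "x \<in> ran (op_minus Some T)" and y: "y \<in> ran (op_minus Some T)" for x y
  proof -
    from x y obtain h u k v where "T h = Some u" "x = h - u" "T k = Some v" "y = k - v"
      unfolding ran_op_minus_Some by blast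
    then have "T (h + k) = Some (u + v)" "x + y = (h + k) - (u + v)"
      using T by auto
    then show ?thesis
      unfolding ran_op_minus_Some by blast
  qed
  show "smul c x \<in> ran (op_minus Some T)" if x: "x \<in> ran (op_minus Some T)" for c x
  proof -
    from x obtain h u where "T h = Some u" "x = h - u"
      unfolding ran_op_minus_Some by blast
    then have "T (smul c h) = Some (smul c u)" "smul c x = smul c h - smul c u"
      using T by (auto simp: scale_right_diff_distrib)
    then show ?thesis
      unfolding ran_op_minus_Some by blast
  qed
qed

text \<open>Symmetry of orthogonality puts the graph in the first argument. For densely defined
  linear \<open>T\<close> the condition says that the adjoint of \<open>T\<close> sends
  \<open>y\<close> to \<open>- x\<close>.\<close>

lemma mem_orthogonal_complement_graph:
  "(x, y) \<in> orthogonal_complement (prod_ip ip) (Map.graph T) \<longleftrightarrow>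
     (\<forall>h u. T h = Some u \<longrightarrow> ip h x + ip u y = 0)"
proof -
  interpret P: hilbert_space "\<lambda>c p. (smul c (fst p), smul c (snd p))" "prod_ip ip"
    using hilbert_space_axioms by (rule hilbert_space_prod)
  show ?thesis
    unfolding orthogonal_complement_def mem_Collect_eq P.ip_eq_0_commute[of "(x, y)"]
    by (auto simp: Map.graph_def prod_ip_def)
qed

lemma closed_orthogonal_complement_graph:
  "closed (orthogonal_complement (prod_ip ip) (Map.graph T))"
proof -
  interpret P: hilbert_space "\<lambda>c p. (smul c (fst p), smul c (snd p))" "prod_ip ip"
    using hilbert_space_axioms by (rule hilbert_space_prod)
  show ?thesis
    by (rule P.closed_orthogonal_complement)
qed

end


section \<open>Skew-symmetric operators\<close>

locale skew_symmetric_operator = hilbert_space smul ip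
  for smul :: "'k::rc_field \<Rightarrow> 'a::banach \<Rightarrow> 'a" and ip :: "'a \<Rightarrow> 'a \<Rightarrow> 'k" +
  fixes S :: "'a \<rightharpoonup> 'a"
  assumes linear: "linear_operator smul S"
    and skew_symmetric: "skew_symmetric ip S"
begin

section \<open>Rules for \<open>S\<close> and the ranges of the operators built from it\<close>

lemma add: "S x = Some u \<Longrightarrow> S y = Some v \<Longrightarrow> S (x + y) = Some (u + v)"
  using linear unfolding linear_operator_iff by blast

lemma scale: "S x = Some u \<Longrightarrow> S (smul c x) = Some (smul c u)"
  using linear unfolding linear_operator_iff by blast

lemma zero: "S 0 = Some 0"
  using linear unfolding linear_operator_iff by blast

lemma diff: "S x = Some u \<Longrightarrow> S y = Some v \<Longrightarrow> S (x - y) = Some (u - v)"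
  using add[of x u "- y" "- v"] scale[of y v "- 1"] by simp

lemma half: "S x = Some u \<Longrightarrow> S ((1/2) *\<^sub>R x) = Some ((1/2) *\<^sub>R u)"
  using scale[of x u "of_real (1/2)"] unfolding scale_of_real .

lemma ip_skew: "S h = Some u \<Longrightarrow> S k = Some v \<Longrightarrow> ip u k = - ip h v"
  using skew_symmetric unfolding skew_symmetric_def by (metis domI option.sel)

text \<open>If \<open>(a, b)\<close> is the image of \<open>(h, k)\<close>, then
  \<open>a + b\<close> is the image of \<open>h + k\<close> under \<open>I + S\<close>, and
  \<open>a - b\<close> is the image of \<open>h - k\<close> under \<open>I - S\<close>.\<close>

lemma ran_block_op_iff:
  "ran (block_op S (op_uminus S)) = UNIV \<longleftrightarrow>
     ran (op_plus Some S) = UNIV \<and> ran (op_minus Some S) = UNIV"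
proof -
  show ?thesis
  proof (intro iffI conjI)
    assume "ran (block_op S (op_uminus S)) = UNIV"
    then have onto: "\<exists>h k u v. S h = Some u \<and> S k = Some v \<and> a = h + v \<and> b = u + k" for a b
      by (metis UNIV_I mem_ran_block_op_uminus)
    have "y \<in> ran (op_plus Some S)" for y
    proof -
      \<comment> \<open>With second component 0, the sum and the difference of the two components
        are both \<open>y\<close>.\<close>
      obtain h k u v where *: "S h = Some u" "S k = Some v" "y = h + v" "0 = u + k"
        using onto by blast
      have "y = (h + k) + (u + v)"
        using * by (simp add: algebra_simps)
      then show ?thesis
        unfolding ran_op_plus_Some using add[OF *(1,2)] by blast
    qed
    then show "ran (op_plus Some S) = UNIV"
      by blast
    have "y \<in> ran (op_minus Some S)" for y
    proof -
      obtain h k u v where *: "S h = Some u" "S k = Some v" "y = h + v" "0 = u + k"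
        using onto by blast
      have "y = (h - k) - (u - v)"
        using * by (simp add: algebra_simps)
      then show ?thesis
        unfolding ran_op_minus_Some using diff[OF *(1,2)] by blast
    qed
    then show "ran (op_minus Some S) = UNIV"
      by blast
  next
    assume onto: "ran (op_plus Some S) = UNIV \<and> ran (op_minus Some S) = UNIV"
    have "(a, b) \<in> ran (block_op S (op_uminus S))" for a b
    proof -
      \<comment> \<open>The vectors \<open>p\<close> and \<open>q\<close> play the roles of
        \<open>h + k\<close> and \<open>h - k\<close>; halving their sum and difference recovers
        \<open>h\<close> and \<open>k\<close>.\<close>
      obtain p u where p: "S p = Some u" "a + b = p + u"
        using onto unfolding ran_op_plus_Some by blast
      obtain q v where q: "S q = Some v" "a - b = q - v"
        using onto unfolding ran_op_minus_Some by blast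
      have "a = (1/2) *\<^sub>R ((a + b) + (a - b))" "b = (1/2) *\<^sub>R ((a + b) - (a - b))"
        by (simp_all add: scaleR_2[symmetric])
      then have "a = (1/2) *\<^sub>R (p + q) + (1/2) *\<^sub>R (u - v)"
        "b = (1/2) *\<^sub>R (u + v) + (1/2) *\<^sub>R (p - q)"
        unfolding p(2) q(2) by (simp_all add: algebra_simps)
      then show ?thesis
        unfolding mem_ran_block_op_uminus using half[OF add[OF p(1) q(1)]] half[OF diff[OF p(1) q(1)]] by blast
    qed
    then show "ran (block_op S (op_uminus S)) = UNIV"
      by auto
  qed
qed

text \<open>On the domain of \<open>S^2\<close>, \<open>I - S^2\<close> factors both as
  \<open>(I + S)(I - S)\<close> and as \<open>(I - S)(I + S)\<close>, so its surjectivity passes to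
  both factors. Conversely, solve with \<open>I - S\<close> first and then with
  \<open>I + S\<close>.\<close>

lemma ran_op_minus_square_iff:
  "ran (op_minus Some (S \<circ>\<^sub>m S)) = UNIV \<longleftrightarrow>
     ran (op_plus Some S) = UNIV \<and> ran (op_minus Some S) = UNIV"
proof (intro iffI conjI)
  assume "ran (op_minus Some (S \<circ>\<^sub>m S)) = UNIV"
  then have onto: "\<exists>h w u. S h = Some w \<and> S w = Some u \<and> y = h - u" for y
    unfolding ran_op_minus_Some map_comp_eq_Some_iff by blast
  have "y \<in> ran (op_plus Some S)" for y
  proof -
    obtain h w u where *: "S h = Some w" "S w = Some u" "y = h - u"
      using onto by blast
    then have "S (h - w) = Some (w - u)" "y = (h - w) + (w - u)"
      using diff by auto
    then show ?thesis
      unfolding ran_op_plus_Some by blast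
  qed
  then show "ran (op_plus Some S) = UNIV"
    by blast
  have "y \<in> ran (op_minus Some S)" for y
  proof -
    obtain h w u where *: "S h = Some w" "S w = Some u" "y = h - u"
      using onto by blast
    then have "S (h + w) = Some (w + u)" "y = (h + w) - (w + u)"
      using add by auto
    then show ?thesis
      unfolding ran_op_minus_Some by blast
  qed
  then show "ran (op_minus Some S) = UNIV"
    by blast
next
  assume onto: "ran (op_plus Some S) = UNIV \<and> ran (op_minus Some S) = UNIV"
  have "y \<in> ran (op_minus Some (S \<circ>\<^sub>m S))" for y
  proof -
    obtain q v where q: "S q = Some v" "y = q - v"
      using onto unfolding ran_op_minus_Some by blast
    obtain p u where p: "S p = Some u" "q = p + u"
      using onto unfolding ran_op_plus_Some by blast
    \<comment> \<open>Since \<open>u = q - p\<close> is a difference of vectors in the domain of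
      \<open>S\<close>, \<open>p\<close> lies in the domain of \<open>S^2\<close>.\<close>
    have "S u = Some (v - u)"
      using diff[OF q(1) p(1)] p(2) by simp
    moreover have "y = p - (v - u)"
      using p q by simp
    ultimately show ?thesis
      unfolding ran_op_minus_Some map_comp_eq_Some_iff using p(1) by blast
  qed
  then show "ran (op_minus Some (S \<circ>\<^sub>m S)) = UNIV"
    by blast
qed

section \<open>Skew-adjointness and the orthogonal complement of the graph\<close>

lemma skew_adjointI:
  assumes "ran (op_plus Some S) = UNIV" "ran (op_minus Some S) = UNIV"
  shows "skew_adjoint ip S"
proof -
  have "ip u k = ip h v" if "S h = Some u" "op_uminus S k = Some v" for h u k v
    using ip_skew[of h u k "- v"] that by (simp add: op_uminus_eq_Some_iff)
  moreover have "op_uminus S 0 = Some 0"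
    using zero by (simp add: op_uminus_eq_Some_iff)
  moreover have "ran (op_minus Some (op_uminus S)) = UNIV"
    using assms(1) by (simp add: op_minus_op_uminus)
  ultimately show ?thesis
    using adjoint_op_eqI[OF subspace_dom[OF linear], of "op_uminus S"] assms(2)
    unfolding skew_adjoint_def by blast
qed

text \<open>Orthogonality of \<open>(x, y)\<close> to the graph says that the adjoint of
  \<open>S\<close> sends \<open>y\<close> to \<open>- x\<close>. Hence \<open>S\<close> sends
  \<open>y\<close> to \<open>x\<close>, and \<open>(x, y)\<close> is the image of
  \<open>(0, y)\<close>.\<close>

lemma orthogonal_complement_graph_subset:
  assumes "skew_adjoint ip S"
  shows "orthogonal_complement (prod_ip ip) (Map.graph S) \<subseteq> ran (block_op S (op_uminus S))"
proof clarify
  fix x y assume *: "(x, y) \<in> orthogonal_complement (prod_ip ip) (Map.graph S)"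
  have dense: "densely_defined S" and adj: "adjoint_op ip S = op_uminus S"
    using assms by (simp_all add: skew_adjoint_def)
  have "adjoint_op ip S y = Some (- x)"
    unfolding adjoint_op_eq_Some_iff[OF subspace_dom[OF linear] dense]
    using * by (simp add: mem_orthogonal_complement_graph add_eq_0_iff)
  then have "S y = Some x"
    by (simp add: adj op_uminus_eq_Some_iff)
  then show "(x, y) \<in> ran (block_op S (op_uminus S))"
    unfolding mem_ran_block_op_uminus using zero by force
qed

lemma ran_block_op_eq_UNIV:
  assumes "orthogonal_complement (prod_ip ip) (Map.graph S) \<subseteq> ran (block_op S (op_uminus S))"
  shows "ran (block_op S (op_uminus S)) = UNIV"
proof -
  have swap: "(x, y) \<in> orthogonal_complement (prod_ip ip) (Map.graph S) \<longleftrightarrow> S y = Some x" for x y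
  proof
    assume xy: "(x, y) \<in> orthogonal_complement (prod_ip ip) (Map.graph S)"
    then obtain h k u v where *: "S h = Some u" "S k = Some v" "x = h + v" "y = u + k"
      using assms mem_ran_block_op_uminus by blast
    \<comment> \<open>Test \<open>(x, y)\<close> against the graph point \<open>(h, u)\<close>: the
      mixed terms cancel by skew-symmetry, leaving the squared norms of \<open>h\<close> and
      \<open>u\<close>.\<close>
    have "ip h x + ip u y = 0"
      using xy *(1) unfolding mem_orthogonal_complement_graph by blast
    then have "ip h h + ip u u = 0"
      using ip_skew[OF *(1,2)] by (simp add: * ip_add_right ip_diff_right)
    then have "(of_real ((norm h)\<^sup>2 + (norm u)\<^sup>2) :: 'k) = 0"
      by (simp add: ip_self)
    then have "h = 0" "u = 0"
      by (simp_all only: of_real_eq_0_iff) (simp_all add: sum_power2_eq_zero_iff)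
    then show "S y = Some x"
      using * by simp
  next
    assume "S y = Some x"
    then show "(x, y) \<in> orthogonal_complement (prod_ip ip) (Map.graph S)"
      unfolding mem_orthogonal_complement_graph using ip_skew by simp
  qed
  have "Map.graph S = prod.swap -` orthogonal_complement (prod_ip ip) (Map.graph S)"
    using swap by (auto simp: Map.graph_def)
  moreover have "closed (prod.swap -` orthogonal_complement (prod_ip ip) (Map.graph S))"
    by (intro closed_vimage closed_orthogonal_complement_graph continuous_on_swap)
  ultimately have closed: "closed (Map.graph S)"
    by simp
  interpret P: hilbert_space "\<lambda>c p. (smul c (fst p), smul c (snd p))" "prod_ip ip"
    using hilbert_space_axioms by (rule hilbert_space_prod)
  have "(x, y) \<in> ran (block_op S (op_uminus S))" for x y
  proof -
    obtain g where g: "g \<in> Map.graph S"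
      "(x, y) - g \<in> orthogonal_complement (prod_ip ip) (Map.graph S)"
      using P.orthogonal_decomposition[OF closed subspace_graph[OF linear], of "(x, y)"] by blast
    obtain h u where h: "g = (h, u)" "S h = Some u"
      using g(1) by (auto simp: Map.graph_def)
    \<comment> \<open>The remainder is a flipped graph point, so \<open>(x, y)\<close> is the image
      of \<open>(h, y - u)\<close> under the block operator.\<close>
    have "S (y - u) = Some (x - h)"
      using g(2) by (simp add: h(1) swap)
    then show ?thesis
      unfolding mem_ran_block_op_uminus using h(2) by force
  qed
  then show ?thesis
    by auto
qed

section \<open>The square of a skew-symmetric operator\<close>

lemma ip_square:
  assumes "(S \<circ>\<^sub>m S) h = Some u" "(S \<circ>\<^sub>m S) k = Some v"
  shows "ip u k = ip h v"
  using assms ip_skew by (auto simp: map_comp_eq_Some_iff)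

text \<open>Take \<open>w\<close> to be the image of \<open>h\<close> under \<open>S\<close>. This
  expresses that \<open>S^2\<close> is nonpositive without an order on the scalars.\<close>

lemma square_nonpos:
  assumes "(S \<circ>\<^sub>m S) h = Some u"
  obtains w where "ip u h = - ip w w" "ip h u = - ip w w"
  using assms ip_skew[of h _ _ u] ip_skew[of _ u h] by (fastforce simp: map_comp_eq_Some_iff)

lemma square_selfadjoint:
  assumes "ran (op_minus Some (S \<circ>\<^sub>m S)) = UNIV"
  shows "densely_defined (S \<circ>\<^sub>m S)" "adjoint_op ip (S \<circ>\<^sub>m S) = S \<circ>\<^sub>m S"
proof -
  have "subspace (dom (S \<circ>\<^sub>m S))"
    using linear_operator_map_comp[OF linear linear] by (rule subspace_dom)
  moreover have "(S \<circ>\<^sub>m S) 0 = Some 0"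
    using zero by (simp add: map_comp_eq_Some_iff)
  ultimately show "densely_defined (S \<circ>\<^sub>m S)" "adjoint_op ip (S \<circ>\<^sub>m S) = S \<circ>\<^sub>m S"
    using adjoint_op_eqI[of "S \<circ>\<^sub>m S" "S \<circ>\<^sub>m S"] assms ip_square by blast+
qed

lemma ran_op_minus_square_eq_UNIV:
  assumes dense: "densely_defined (S \<circ>\<^sub>m S)" and selfadj: "adjoint_op ip (S \<circ>\<^sub>m S) = S \<circ>\<^sub>m S"
  shows "ran (op_minus Some (S \<circ>\<^sub>m S)) = UNIV"
proof -
  define T where "T = S \<circ>\<^sub>m S"
  have lin: "linear_operator smul T"
    unfolding T_def using linear linear by (rule linear_operator_map_comp)
  have T_iff: "T x = Some y \<longleftrightarrow> (\<forall>h u. T h = Some u \<longrightarrow> ip u x = ip h y)" for x y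
    using adjoint_op_eq_Some_iff[OF subspace_dom[OF lin], of x y] dense selfadj
    by (simp add: T_def)
  interpret P: hilbert_space "\<lambda>c p. (smul c (fst p), smul c (snd p))" "prod_ip ip"
    using hilbert_space_axioms by (rule hilbert_space_prod)
  \<comment> \<open>Selfadjointness makes the graph a rotated copy of its own orthogonal complement,
    and therefore closed.\<close>
  have "(x, y) \<in> Map.graph T \<longleftrightarrow>
      (- y, x) \<in> orthogonal_complement (prod_ip ip) (Map.graph T)" for x y
    unfolding mem_orthogonal_complement_graph in_graph_iff T_iff[of x y] by simp
  then have "Map.graph T =
      (\<lambda>p. (- snd p, fst p)) -` orthogonal_complement (prod_ip ip) (Map.graph T)"
    by (intro set_eqI) (simp only: vimage_eq split_paired_all fst_conv snd_conv)
  moreover have "closed ((\<lambda>p. (- snd p, fst p)) -` orthogonal_complement (prod_ip ip) (Map.graph T))"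
    by (intro closed_vimage closed_orthogonal_complement_graph continuous_intros)
  ultimately have "complete (Map.graph T)"
    unfolding complete_eq_closed by (rule ssubst)
  \<comment> \<open>Both mixed terms of the squared norm of \<open>h - u\<close> contribute the
    squared norm of \<open>w\<close> with a plus sign, so \<open>(h, u) \<mapsto> h - u\<close> is
    bounded below by 1 on the graph. Its image is then complete.\<close>
  moreover have "norm p \<le> norm (fst p - snd p)" if "p \<in> Map.graph T" for p
  proof -
    obtain h u where p: "p = (h, u)" "T h = Some u"
      using \<open>p \<in> _\<close> by (auto simp: Map.graph_def)
    obtain w where w: "ip u h = - ip w w" "ip h u = - ip w w"
      using square_nonpos p(2) unfolding T_def by blast
    have "ip (h - u) (h - u) = ip h h + ip u u + 2 * ip w w"
      by (simp add: ip_diff_left ip_diff_right w)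
    then have "(of_real ((norm (h - u))\<^sup>2) :: 'k) = of_real ((norm h)\<^sup>2 + (norm u)\<^sup>2 + 2 * (norm w)\<^sup>2)"
      by (simp add: ip_self)
    then have "(norm (h - u))\<^sup>2 = (norm h)\<^sup>2 + (norm u)\<^sup>2 + 2 * (norm w)\<^sup>2"
      unfolding of_real_eq_iff .
    then show ?thesis
      by (simp add: p(1) norm_prod_def real_le_lsqrt)
  qed
  then have "\<forall>p\<in>Map.graph T. 1 * norm p \<le> norm (fst p - snd p)"
    by simp
  moreover have "bounded_linear (\<lambda>p :: 'a \<times> 'a. fst p - snd p)"
    by (intro bounded_linear_sub bounded_linear_fst bounded_linear_snd)
  ultimately have "complete ((\<lambda>p. fst p - snd p) ` Map.graph T)"
    using complete_isometric_image[of 1 "Map.graph T"] P.real_subspace[OF subspace_graph[OF lin]]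
    by simp
  also have "(\<lambda>p. fst p - snd p) ` Map.graph T = ran (op_minus Some T)"
    unfolding ran_op_minus_Some Map.graph_def image_def Bex_def split_paired_Ex by auto
  finally have closed: "closed (ran (op_minus Some T))"
    by (simp add: complete_eq_closed)
  have "z = 0" if z: "z \<in> orthogonal_complement ip (ran (op_minus Some T))" for z
  proof -
    \<comment> \<open>This says that the adjoint of \<open>T\<close> fixes \<open>z\<close>, hence
      so does \<open>T\<close>. Nonpositivity then makes the squared norm of \<open>z\<close> the
      negative of another squared norm.\<close>
    have "ip (h - u) z = 0" if "T h = Some u" for h u
      using z that ip_eq_0_commute[of z "h - u"]
      unfolding orthogonal_complement_def ran_op_minus_Some by blast
    then have "T z = Some z"
      using T_iff[of z z] by (simp add: ip_diff_left)
    then obtain w where "ip z z = - ip w w"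
      using square_nonpos unfolding T_def by blast
    then have "(of_real ((norm z)\<^sup>2 + (norm w)\<^sup>2) :: 'k) = 0"
      by (simp add: ip_self)
    then show ?thesis
      by (simp only: of_real_eq_0_iff) (simp add: sum_power2_eq_zero_iff)
  qed
  then have "closure (ran (op_minus Some T)) = UNIV"
    unfolding closure_eq_UNIV_iff[OF subspace_ran_op_minus[OF lin]] by blast
  then show ?thesis
    using closed by (simp add: T_def)
qed

end

theorem theorem6p1:
  fixes smul :: "'k::rc_field \<Rightarrow> 'a::banach \<Rightarrow> 'a"
    and ip :: "'a \<Rightarrow> 'a \<Rightarrow> 'k"
    and S :: "'a \<rightharpoonup> 'a"
  assumes "hilbert_space smul ip"
    and "linear_operator smul S"
    and "skew_symmetric ip S"
  shows "(skew_adjoint ip S \<longleftrightarrow> ran (block_op S (op_uminus S)) = UNIV)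
    \<and> (skew_adjoint ip S \<longleftrightarrow>
         orthogonal_complement (prod_ip ip) (Map.graph S) \<subseteq> ran (block_op S (op_uminus S)))
    \<and> (skew_adjoint ip S \<longleftrightarrow> ran (op_minus Some (S \<circ>\<^sub>m S)) = UNIV)
    \<and> (skew_adjoint ip S \<longleftrightarrow>
         ran (op_plus Some S) = UNIV \<and> ran (op_minus Some S) = UNIV)
    \<and> (skew_adjoint ip S \<longleftrightarrow>
         densely_defined (S \<circ>\<^sub>m S) \<and> adjoint_op ip (S \<circ>\<^sub>m S) = S \<circ>\<^sub>m S)"
proof -
  interpret skew_symmetric_operator smul ip S
    using assms by (simp add: skew_symmetric_operator_def skew_symmetric_operator_axioms_def)
  \<comment> \<open>The implications combined are (ii) iff (v), (iv) iff (v), the chain (v) to (i)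
    to (iii) to (ii), and (iv) iff (vi).\<close>
  show ?thesis
    using ran_block_op_iff ran_op_minus_square_iff skew_adjointI ran_block_op_eq_UNIV
      orthogonal_complement_graph_subset square_selfadjoint ran_op_minus_square_eq_UNIV
    by metis
qed

end
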